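(* Let $d\geq 1$ and $k\geq 2$ be integers. Then for all sufficiently large $n$, there exists a linear nearly-$d$-regular $k$-uniform hypergraph on $n$ vertices.
   Context: A $k$-uniform hypergraph has edges that are $k$-element subsets of its vertex set, with no repeated edges. It is linear if any two distinct edges share at most one vertex. The degree of a vertex is the number of edges containing it. A $k$-uniform hypergraph is nearly-$d$-regular if every vertex has degree $d$ or $d-1$, and fewer than $k$ vertices have degree $d-1$. *)

theory Defs
  imports Main
begin

definition uniform_hypergraph :: "nat \<Rightarrow> 'a set \<Rightarrow> 'a set set \<Rightarrow> bool" where
  "uniform_hypergraph k V E \<longleftrightarrow> finite V \<and> (\<forall>e\<in>E. e \<subseteq> V \<and> card e = k)"

definition linear_hypergraph :: "'a set set \<Rightarrow> bool" where
  "linear_hypergraph E \<longleftrightarrow> (\<forall>e\<in>E. \<forall>f\<in>E. e \<noteq> f \<longrightarrow> card (e \<inter> f) \<le> 1)"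

definition hdegree :: "'a set set \<Rightarrow> 'a \<Rightarrow> nat" where
  "hdegree E v = card {e \<in> E. v \<in> e}"

(* Meant for d \<ge> 1, since d - 1 is truncated subtraction. *)
definition nearly_regular :: "nat \<Rightarrow> nat \<Rightarrow> 'a set \<Rightarrow> 'a set set \<Rightarrow> bool" where
  "nearly_regular d k V E \<longleftrightarrow>
     (\<forall>v\<in>V. hdegree E v = d \<or> hdegree E v = d - 1) \<and>
     card {v \<in> V. hdegree E v = d - 1} < k"

end

theory Submission
  imports Defs
begin

text \<open>
  Among the linear \<open>k\<close>-uniform hypergraphs on \<open>V\<close> with maximum degree at most \<open>d\<close>, take one that
  minimises the sum over all vertices of the squared deficiency \<open>d - deg v\<close>. If it does not cover
  all but fewer than \<open>k\<close> vertices, a new edge on uncovered vertices can be added; so it has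
  many edges, and edges far from any bounded set of vertices exist. If \<open>k\<close> distinct vertices are
  deficient, put them in the first row of a \<open>k \<times> k\<close> grid whose other rows are edges that are
  pairwise far apart and far from the first row, and replace these \<open>k - 1\<close> rows by the \<open>k\<close> columns:
  only the degrees of the deficient vertices change, by \<open>+1\<close>. If fewer than \<open>k\<close> vertices are
  deficient but some \<open>v\<close> has deficiency at least 2, replace an edge \<open>e\<close> far from all of them
  by \<open>e - u + v\<close> for some \<open>u \<in> e\<close>. Both switches decrease the sum of squares.
\<close>

text \<open>This is the condition that keeps switches linear: a new edge with at most one vertex in
  each of several pairwise far apart sets, and none elsewhere, shares at most one vertex with any
  old edge.\<close>

definition far_apart :: "'a set set \<Rightarrow> 'a set \<Rightarrow> 'a set \<Rightarrow> bool" where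
  "far_apart E A B \<longleftrightarrow> (\<forall>f\<in>E. f \<inter> A = {} \<or> f \<inter> B = {})"

definition bounded_linear_hypergraph :: "nat \<Rightarrow> nat \<Rightarrow> 'a set \<Rightarrow> 'a set set \<Rightarrow> bool" where
  "bounded_linear_hypergraph d k V E \<longleftrightarrow>
     uniform_hypergraph k V E \<and> linear_hypergraph E \<and> (\<forall>v\<in>V. hdegree E v \<le> d)"

lemma uniform_hypergraph_finite:
  "uniform_hypergraph k V E \<Longrightarrow> finite E"
  unfolding uniform_hypergraph_def by (meson PowI finite_Pow_iff finite_subset subsetI)

lemma far_apart_imp_disjoint:
  "far_apart E A B \<Longrightarrow> B \<in> E \<Longrightarrow> A \<inter> B = {}"
  unfolding far_apart_def by blast

section \<open>Replacing a disjoint family of edges by another\<close>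

lemma hdegree_disjoint_family:
  assumes "pairwise disjnt C"
  shows "hdegree C v = of_bool (v \<in> \<Union>C)"
proof (cases "v \<in> \<Union>C")
  case True
  then obtain c where c: "c \<in> C" "v \<in> c" by blast
  have "{e \<in> C. v \<in> e} = {c}"
    using c assms by (auto simp: pairwise_def disjnt_def)
  then show ?thesis using True by (simp add: hdegree_def)
next
  case False
  then have "{e \<in> C. v \<in> e} = {}" by blast
  then show ?thesis using False unfolding hdegree_def by (simp only: card.empty of_bool_eq)
qed

text \<open>Both sides count the kept edges, \<open>R\<close> and \<open>C\<close> once each. The
  additive form avoids truncated subtraction.\<close>

lemma hdegree_switch:
  assumes "finite E" "finite C" "R \<subseteq> E" "C \<inter> (E - R) = {}"
  shows "hdegree (E - R \<union> C) v + hdegree R v = hdegree E v + hdegree C v"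
proof -
  have fin: "finite R" using assms finite_subset by blast
  have "card {e \<in> E - R \<union> C. v \<in> e} = card {e \<in> E - R. v \<in> e} + card {e \<in> C. v \<in> e}"
    using assms by (subst card_Un_disjoint[symmetric]) (auto intro!: arg_cong[where f=card])
  moreover have "card {e \<in> E. v \<in> e} = card {e \<in> E - R. v \<in> e} + card {e \<in> R. v \<in> e}"
    using assms fin by (subst card_Un_disjoint[symmetric]) (auto intro!: arg_cong[where f=card])
  ultimately show ?thesis by (simp add: hdegree_def)
qed

text \<open>The common core of all three switches. Disjointness of \<open>C\<close> settles pairs of
  new edges, so only old against new has to be supplied as \<open>EC\<close>; disjointness of
  \<open>R\<close> and \<open>C\<close> makes every degree change a difference of two
  indicators.\<close>

lemma switch_linear_uniform:
  assumes k: "k \<ge> 2"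
    and E: "uniform_hypergraph k V E" "linear_hypergraph E"
    and R: "R \<subseteq> E" "pairwise disjnt R"
    and C: "pairwise disjnt C" "\<And>c. c \<in> C \<Longrightarrow> c \<subseteq> V \<and> card c = k"
    and EC: "\<And>f c. f \<in> E - R \<Longrightarrow> c \<in> C \<Longrightarrow> card (f \<inter> c) \<le> 1"
  shows "uniform_hypergraph k V (E - R \<union> C)" (is ?U)
    and "linear_hypergraph (E - R \<union> C)" (is ?L)
    and "hdegree (E - R \<union> C) v + of_bool (v \<in> \<Union>R) = hdegree E v + of_bool (v \<in> \<Union>C)"
proof -
  show ?U using E C(2) unfolding uniform_hypergraph_def by blast
  show ?L unfolding linear_hypergraph_def
  proof (intro ballI impI)
    fix e f assume ef: "e \<in> E - R \<union> C" "f \<in> E - R \<union> C" "e \<noteq> f"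
    consider "e \<in> E" "f \<in> E" | "e \<in> E - R" "f \<in> C" | "e \<in> C" "f \<in> E - R" | "e \<in> C" "f \<in> C"
      using ef by blast
    then show "card (e \<inter> f) \<le> 1"
    proof cases
      case 1 then show ?thesis using E(2) ef unfolding linear_hypergraph_def by blast
    next
      case 2 then show ?thesis using EC by blast
    next
      case 3 then show ?thesis using EC[of f e] by (simp add: Int_commute)
    next
      case 4 then show ?thesis using C(1) ef by (simp add: pairwise_def disjnt_def)
    qed
  qed
  \<comment> \<open>A new edge equal to a kept one would meet it in \<open>k \<ge> 2\<close>
    vertices, against \<open>EC\<close>.\<close>
  have disj: "C \<inter> (E - R) = {}"
  proof (rule ccontr)
    assume "C \<inter> (E - R) \<noteq> {}"
    then obtain c where "c \<in> C" "c \<in> E - R" by blast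
    then show False using EC[of c c] C(2)[of c] k by simp
  qed
  have "finite C" using \<open>?U\<close> uniform_hypergraph_finite by (metis finite_Un)
  then show "hdegree (E - R \<union> C) v + of_bool (v \<in> \<Union>R) = hdegree E v + of_bool (v \<in> \<Union>C)"
    using hdegree_switch[OF uniform_hypergraph_finite[OF E(1)] _ R(1) disj]
    by (simp add: hdegree_disjoint_family[OF R(2)] hdegree_disjoint_family[OF C(1)])
qed

section \<open>Edges far from a small set of vertices\<close>

lemma card_edges_meeting:
  assumes E: "bounded_linear_hypergraph d k V E" and W: "W \<subseteq> V"
  shows "card {e \<in> E. e \<inter> W \<noteq> {}} \<le> card W * d"
proof -
  have "finite W" using E W finite_subset
    unfolding bounded_linear_hypergraph_def uniform_hypergraph_def by blast
  moreover have "{e \<in> E. e \<inter> W \<noteq> {}} = (\<Union>v\<in>W. {e \<in> E. v \<in> e})" by blast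
  ultimately have "card {e \<in> E. e \<inter> W \<noteq> {}} \<le> (\<Sum>v\<in>W. hdegree E v)"
    unfolding hdegree_def by (simp add: card_UN_le)
  also have "\<dots> \<le> (\<Sum>v\<in>W. d)"
    using E W unfolding bounded_linear_hypergraph_def by (intro sum_mono) blast
  finally show ?thesis by simp
qed

text \<open>At most \<open>card W * d\<close> edges meet \<open>W\<close>; they cover at most
  \<open>card W * d * k\<close> vertices, which in turn meet at most
  \<open>card W * d * k * d\<close> edges. Any edge outside this second neighbourhood will
  do.\<close>

lemma far_edge_exists:
  assumes k: "k \<ge> 1" and E: "bounded_linear_hypergraph d k V E"
    and W: "W \<subseteq> V" and large: "card W * d * k * d < card E"
  obtains e where "e \<in> E" "far_apart E W e" "e \<inter> W = {}"
proof -
  have U: "uniform_hypergraph k V E"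
    using E unfolding bounded_linear_hypergraph_def by simp
  have finE: "finite E" using uniform_hypergraph_finite[OF U] .
  define F where "F = {e \<in> E. e \<inter> W \<noteq> {}}"
  have finF: "finite F" unfolding F_def using finE by simp
  have "card (\<Union>F) \<le> (\<Sum>e\<in>F. card e)"
    by (rule card_Union_le_sum_card)
  also have "\<dots> = card F * k"
    using U unfolding F_def uniform_hypergraph_def by simp
  also have "\<dots> \<le> card W * d * k"
    unfolding F_def using card_edges_meeting[OF E W] by simp
  finally have "card (\<Union>F) \<le> card W * d * k" .
  moreover have "\<Union>F \<subseteq> V" using U unfolding F_def uniform_hypergraph_def by blast
  ultimately have "card {e \<in> E. e \<inter> \<Union>F \<noteq> {}} \<le> card W * d * k * d"
    using card_edges_meeting[OF E] by (meson le_trans mult_le_mono1)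
  then have "{e \<in> E. e \<inter> \<Union>F \<noteq> {}} \<noteq> E" using large by force
  then obtain e where e: "e \<in> E" "e \<inter> \<Union>F = {}" by blast
  \<comment> \<open>An empty \<open>e\<close> could belong to \<open>F\<close> and still miss its
    union.\<close>
  have "e \<noteq> {}" using U e(1) k unfolding uniform_hypergraph_def by force
  then have "e \<notin> F" using e(2) by blast
  then have "e \<inter> W = {}" using e(1) unfolding F_def by blast
  moreover have "far_apart E W e" using e(2) unfolding far_apart_def F_def by blast
  ultimately show thesis using that e(1) by blast
qed

text \<open>Greedy choice: the rows already chosen cover at most \<open>k * k\<close> vertices,
  which is where the first factor of the edge bound comes from. Only the rows with positive index
  have to be edges.\<close>

lemma far_apart_rows_exist:
  assumes k: "k \<ge> 1" and E: "bounded_linear_hypergraph d k V E"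
    and S: "S \<subseteq> V" "card S = k"
    and large: "k * k * d * k * d < card E"
    and "m < k"
  shows "\<exists>r :: nat \<Rightarrow> 'a set. r 0 = S \<and> (\<forall>j. 0 < j \<and> j \<le> m \<longrightarrow> r j \<in> E) \<and>
           (\<forall>i j. i < j \<and> j \<le> m \<longrightarrow> far_apart E (r i) (r j))"
  using \<open>m < k\<close>
proof (induction m)
  case 0
  show ?case by (rule exI[of _ "\<lambda>_. S"]) simp
next
  case (Suc m)
  then obtain r where r: "r 0 = S" "\<And>j. 0 < j \<Longrightarrow> j \<le> m \<Longrightarrow> r j \<in> E"
      "\<And>i j. i < j \<Longrightarrow> j \<le> m \<Longrightarrow> far_apart E (r i) (r j)"
    by auto
  have U: "\<And>e. e \<in> E \<Longrightarrow> e \<subseteq> V \<and> card e = k"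
    using E unfolding bounded_linear_hypergraph_def uniform_hypergraph_def by simp
  have row: "r j \<subseteq> V \<and> card (r j) = k" if "j \<le> m" for j
    using that U r(1,2) S by (cases "j = 0") auto
  define W where "W = (\<Union>i\<le>m. r i)"
  have W: "W \<subseteq> V" using row unfolding W_def by blast
  have "card W \<le> (\<Sum>i\<le>m. card (r i))" unfolding W_def by (simp add: card_UN_le)
  also have "\<dots> = (m + 1) * k" using row by simp
  also have "\<dots> \<le> k * k" using Suc.prems by (intro mult_le_mono1) simp
  finally have "card W * d * k * d < card E"
    using large by (meson le_less_trans mult_le_mono1)
  then obtain e where e: "e \<in> E" "far_apart E W e"
    using far_edge_exists[OF k E W] by blast
  have "far_apart E (r i) e" if "i \<le> m" for i
    using that e(2) unfolding far_apart_def W_def by blast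
  then show ?case using r e(1)
    by (intro exI[of _ "r(Suc m := e)"]) (auto simp: le_Suc_eq)
qed

section \<open>The three switches\<close>

text \<open>Every vertex of the grid gains a column, and those outside the first row
  \<open>S\<close> also lose a row. Linearity survives because an old edge meets at most one row,
  while a column has a single vertex in each row.\<close>

lemma grid_switch:
  fixes V :: "'a set"
  assumes k: "k \<ge> 2" and E: "bounded_linear_hypergraph d k V E"
    and S: "S \<subseteq> V" "card S = k"
    and large: "k * k * d * k * d < card E"
  obtains E' where "uniform_hypergraph k V E'" "linear_hypergraph E'"
    "\<And>v. hdegree E' v = hdegree E v + of_bool (v \<in> S)"
proof -
  have U: "uniform_hypergraph k V E" and L: "linear_hypergraph E"
    using E unfolding bounded_linear_hypergraph_def by auto
  have edge: "\<And>e. e \<in> E \<Longrightarrow> e \<subseteq> V \<and> card e = k" and finV: "finite V"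
    using U unfolding uniform_hypergraph_def by auto
  obtain r :: "nat \<Rightarrow> 'a set" where r0: "r 0 = S"
      and rE: "\<And>j. 0 < j \<Longrightarrow> j < k \<Longrightarrow> r j \<in> E"
      and far: "\<And>i j. i < j \<Longrightarrow> j < k \<Longrightarrow> far_apart E (r i) (r j)"
    using far_apart_rows_exist[OF _ E S large, of "k - 1"] k by fastforce
  have row: "r j \<subseteq> V" "card (r j) = k" if "j < k" for j
    using that edge rE r0 S by (cases "j = 0"; auto)+
  \<comment> \<open>The larger of the two indices is positive, so its row is an edge and
    far-apartness gives disjointness.\<close>
  have rows_disj: "r i \<inter> r j = {}" if "i < k" "j < k" "i \<noteq> j" for i j
    using far_apart_imp_disjoint[OF far rE] that
    by (metis Int_commute gr_zeroI less_zeroE linorder_neqE_nat)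
  have meets_one_row: "i = j"
    if "f \<in> E" "i < k" "j < k" "f \<inter> r i \<noteq> {}" "f \<inter> r j \<noteq> {}" for f i j
    using far[of i j] far[of j i] that unfolding far_apart_def
    by (metis linorder_neqE_nat)
  have "\<exists>h. bij_betw h {..<k} (r j)" if "j < k" for j
    using row[OF that] finV
    by (intro finite_same_card_bij) (auto intro: finite_subset)
  \<comment> \<open>\<open>x j i\<close> is the grid entry in row \<open>j\<close> and column
    \<open>i\<close>.\<close>
  then obtain x where x: "\<And>j. j < k \<Longrightarrow> bij_betw (x j) {..<k} (r j)" by metis
  have x_in: "x j i \<in> r j" if "i < k" "j < k" for i j
    using x[OF that(2)] that(1) by (auto simp: bij_betw_def)
  have x_inj: "i = i' \<and> j = j'"
    if "i < k" "j < k" "i' < k" "j' < k" "x j i = x j' i'" for i j i' j'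
  proof -
    have "j = j'" using rows_disj[of j j'] x_in that by (metis disjoint_iff)
    moreover from this have "i = i'" using x[of j] that by (auto simp: bij_betw_def inj_on_def)
    ultimately show ?thesis by simp
  qed
  define R where "R = r ` {0<..<k}"
  define col where "col i = (\<lambda>j. x j i) ` {..<k}" for i
  define C where "C = col ` {..<k}"
  have "R \<subseteq> E" using rE unfolding R_def by auto
  moreover have "pairwise disjnt R"
  proof (rule pairwiseI)
    fix a b assume ab: "a \<in> R" "b \<in> R" "a \<noteq> b"
    from ab(1,2) obtain i j where ij: "i < k" "j < k" "a = r i" "b = r j"
      unfolding R_def by (auto simp only: image_iff greaterThanLessThan_iff)
    then have "i \<noteq> j" using ab(3) by blast
    then show "disjnt a b" using rows_disj[of i j] ij by (simp add: disjnt_def)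
  qed
  ultimately have R: "R \<subseteq> E" "pairwise disjnt R" .
  have C: "pairwise disjnt C"
  proof (rule pairwiseI)
    fix a b assume ab: "a \<in> C" "b \<in> C" "a \<noteq> b"
    from ab(1,2) obtain i j where ij: "i < k" "j < k" "a = col i" "b = col j"
      unfolding C_def by (auto simp only: image_iff lessThan_iff)
    then have neq: "i \<noteq> j" using ab(3) by blast
    have False if "w \<in> a" "w \<in> b" for w
    proof -
      from that ij obtain l m where "l < k" "m < k" "w = x l i" "w = x m j"
        unfolding col_def by auto
      then show False using x_inj[of i l j m] ij neq by simp
    qed
    then show "disjnt a b" by (auto simp: disjnt_def)
  qed
  have Cc: "c \<subseteq> V \<and> card c = k" if "c \<in> C" for c
  proof -
    from that obtain i where i: "i < k" "c = col i" unfolding C_def by blast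
    have "inj_on (\<lambda>j. x j i) {..<k}" using x_inj i by (auto simp: inj_on_def)
    then have "card c = k" using i by (simp add: col_def card_image)
    moreover have "c \<subseteq> V" using i x_in row(1) unfolding col_def by blast
    ultimately show ?thesis by simp
  qed
  have EC: "card (f \<inter> c) \<le> 1" if "f \<in> E - R" "c \<in> C" for f c
  proof -
    from that obtain i where i: "i < k" "c = col i" unfolding C_def by blast
    have "a = b" if "a \<in> f \<inter> c" "b \<in> f \<inter> c" for a b
    proof -
      from that i obtain l m where lm: "l < k" "m < k" "a = x l i" "b = x m i"
        unfolding col_def by auto
      then have "f \<inter> r l \<noteq> {}" "f \<inter> r m \<noteq> {}" using that x_in i by blast+
      then show "a = b" using meets_one_row[of f l m] \<open>f \<in> E - R\<close> lm by simp
    qed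
    moreover have "finite (f \<inter> c)" using i unfolding col_def by simp
    ultimately show ?thesis by (metis One_nat_def card_le_Suc0_iff_eq)
  qed
  \<comment> \<open>Columns and rows cover the same grid, so the columns cover exactly
    \<open>S\<close> more than the removed rows do.\<close>
  have "\<Union>C = (\<Union>j<k. r j)"
  proof -
    have "\<Union>C = (\<Union>j<k. x j ` {..<k})" unfolding C_def col_def by blast
    then show ?thesis using x by (simp add: bij_betw_def)
  qed
  also have "{..<k} = insert 0 {0<..<k}" using k by auto
  finally have UC: "\<Union>C = S \<union> \<Union>R" using r0 unfolding R_def by simp
  have "S \<inter> \<Union>R = {}" using rows_disj[of 0] r0 k unfolding R_def by fastforce
  then have "hdegree (E - R \<union> C) v = hdegree E v + of_bool (v \<in> S)" for v
    using switch_linear_uniform(3)[OF k U L R C Cc EC, of v] UC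
    by (cases "v \<in> S"; cases "v \<in> \<Union>R") (simp_all only: Un_iff of_bool_def if_True if_False, auto)
  then show thesis
    using that switch_linear_uniform(1,2)[OF k U L R C Cc EC] by blast
qed

text \<open>In a far edge \<open>e\<close>, a vertex \<open>u\<close> is exchanged for
  \<open>v\<close>. An old edge through \<open>v\<close> misses \<open>e\<close> by far-apartness,
  so it meets the new edge in \<open>v\<close> alone; any other old edge meets the new one inside
  \<open>e\<close>, where linearity of \<open>E\<close> applies.\<close>

lemma vertex_switch:
  assumes k: "k \<ge> 2" and E: "bounded_linear_hypergraph d k V E"
    and W: "W \<subseteq> V" "v \<in> W" and large: "card W * d * k * d < card E"
  obtains E' u where "uniform_hypergraph k V E'" "linear_hypergraph E'" "u \<in> V - W"
    "\<And>w. hdegree E' w + of_bool (w = u) = hdegree E w + of_bool (w = v)"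
proof -
  have U: "uniform_hypergraph k V E" and L: "linear_hypergraph E"
    using E unfolding bounded_linear_hypergraph_def by auto
  obtain e where e: "e \<in> E" "far_apart E W e" "e \<inter> W = {}"
    using far_edge_exists[OF _ E W(1) large] k by auto
  have ek: "e \<subseteq> V" "card e = k" using U e(1) unfolding uniform_hypergraph_def by auto
  have fin: "finite e" using ek k by (metis card.infinite not_numeral_le_zero)
  obtain u where u: "u \<in> e" using ek k by fastforce
  define c where "c = insert v (e - {u})"
  have ve: "v \<notin> e" using e(3) W(2) by blast
  have c: "c \<subseteq> V \<and> card c = k"
    using ek W u ve fin k unfolding c_def by (auto simp: card_insert_if)
  have Ec: "card (f \<inter> c) \<le> 1" if "f \<in> E - {e}" for f
  proof (cases "v \<in> f")
    case True
    then have "f \<inter> e = {}" using e(2) W(2) that unfolding far_apart_def by blast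
    then have "f \<inter> c \<subseteq> {v}" unfolding c_def by blast
    then show ?thesis using card_mono[of "{v}" "f \<inter> c"] by simp
  next
    case False
    then have "f \<inter> c \<subseteq> f \<inter> e" unfolding c_def by blast
    then have "card (f \<inter> c) \<le> card (f \<inter> e)" using fin by (simp add: card_mono)
    also have "\<dots> \<le> 1" using L e(1) that unfolding linear_hypergraph_def by blast
    finally show ?thesis .
  qed
  have sw: "{e} \<subseteq> E" "pairwise disjnt {e}" "pairwise disjnt {c}" using e(1) by auto
  have c': "\<And>x. x \<in> {c} \<Longrightarrow> x \<subseteq> V \<and> card x = k" using c by blast
  have Ec': "\<And>f x. f \<in> E - {e} \<Longrightarrow> x \<in> {c} \<Longrightarrow> card (f \<inter> x) \<le> 1" using Ec by blast
  note switch = switch_linear_uniform[OF k U L sw c' Ec']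
  have "hdegree (E - {e} \<union> {c}) w + of_bool (w = u) = hdegree E w + of_bool (w = v)" for w
  proof -
    have "of_bool (w \<in> c) + of_bool (w = u) = of_bool (w \<in> e) + (of_bool (w = v) :: nat)"
      using u ve unfolding c_def by auto
    then show ?thesis using switch(3)[of w] by simp
  qed
  moreover note switch(1,2)
  moreover have "u \<in> V - W" using u e(3) ek by blast
  ultimately show thesis using that by blast
qed

text \<open>The edges cover at most \<open>card E * k\<close> vertices, so \<open>k\<close>
  uncovered ones remain, and an edge on these is disjoint from all others.\<close>

lemma fresh_edge:
  assumes k: "k \<ge> 2" and U: "uniform_hypergraph k V E" and L: "linear_hypergraph E"
    and room: "card E * k + k \<le> card V"
  obtains E' S where "uniform_hypergraph k V E'" "linear_hypergraph E'" "S \<subseteq> V" "card S = k"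
    "\<And>v. v \<in> S \<Longrightarrow> hdegree E v = 0"
    "\<And>v. hdegree E' v = hdegree E v + of_bool (v \<in> S)"
proof -
  have edge: "\<And>e. e \<in> E \<Longrightarrow> e \<subseteq> V \<and> card e = k" and finV: "finite V"
    using U unfolding uniform_hypergraph_def by auto
  have "card (\<Union>E) \<le> (\<Sum>e\<in>E. card e)" by (rule card_Union_le_sum_card)
  then have "card (\<Union>E) \<le> card E * k" using edge by simp
  moreover have "\<Union>E \<subseteq> V" using edge by blast
  ultimately have "k \<le> card (V - \<Union>E)"
    using room finV by (subst card_Diff_subset) (auto intro: finite_subset)
  then obtain S where S: "S \<subseteq> V - \<Union>E" "card S = k"
    by (meson obtain_subset_with_card_n)
  have sw: "{} \<subseteq> E" "pairwise disjnt {}" "pairwise disjnt {S}" by auto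
  have ES: "card (f \<inter> S) \<le> 1" if "f \<in> E" for f
  proof -
    have "f \<inter> S = {}" using that S by blast
    then show ?thesis by simp
  qed
  have zero: "hdegree E v = 0" if "v \<in> S" for v
  proof -
    have "{e \<in> E. v \<in> e} = {}" using that S(1) by blast
    then show ?thesis unfolding hdegree_def by (metis card.empty)
  qed
  have S': "\<And>c. c \<in> {S} \<Longrightarrow> c \<subseteq> V \<and> card c = k" using S by blast
  have ES': "\<And>f c. f \<in> E - {} \<Longrightarrow> c \<in> {S} \<Longrightarrow> card (f \<inter> c) \<le> 1" using ES by blast
  note switch = switch_linear_uniform[OF k U L sw S' ES']
  have deg: "hdegree (E - {} \<union> {S}) v = hdegree E v + of_bool (v \<in> S)" for v
    using switch(3)[of v] by simp
  show thesis
    by (rule that[OF switch(1,2) _ S(2) zero deg]) (use S in auto)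
qed

section \<open>The quantity to be minimised\<close>

definition deficiency :: "nat \<Rightarrow> 'a set \<Rightarrow> 'a set set \<Rightarrow> nat" where
  "deficiency d V E = (\<Sum>v\<in>V. (d - hdegree E v)\<^sup>2)"

lemma deficiency_less_raise:
  assumes fin: "finite V" and S: "S \<subseteq> V" "S \<noteq> {}"
    and less: "\<And>v. v \<in> S \<Longrightarrow> hdegree E v < d"
    and deg: "\<And>v. hdegree E' v = hdegree E v + of_bool (v \<in> S)"
  shows "deficiency d V E' < deficiency d V E"
proof -
  obtain s where s: "s \<in> S" using S by blast
  show ?thesis unfolding deficiency_def
  proof (rule sum_strict_mono_ex1[OF fin])
    show "\<forall>v\<in>V. (d - hdegree E' v)\<^sup>2 \<le> (d - hdegree E v)\<^sup>2"
      by (auto simp: deg intro!: power_mono)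
    show "\<exists>v\<in>V. (d - hdegree E' v)\<^sup>2 < (d - hdegree E v)\<^sup>2"
      using s S less[OF s] by (intro bexI[of _ s]) (auto simp: deg intro!: power_strict_mono)
  qed
qed

text \<open>This is the reason for squaring: the move leaves the plain sum of deficiencies
  unchanged, but it evens them out. With \<open>t + 2\<close> the deficiency of \<open>v\<close>,
  the gain \<open>(t + 2)\<^sup>2 - (t + 1)\<^sup>2 = 2 * t + 3\<close> exceeds the cost 1 at
  \<open>u\<close>.\<close>

lemma deficiency_less_move:
  assumes fin: "finite V" and uv: "u \<in> V" "v \<in> V" "u \<noteq> v"
    and u: "hdegree E u = d" and v: "hdegree E v + 2 \<le> d"
    and deg: "\<And>w. hdegree E' w + of_bool (w = u) = hdegree E w + of_bool (w = v)"
  shows "deficiency d V E' < deficiency d V E"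
proof -
  have split: "sum f V = f u + f v + sum f (V - {u} - {v})" for f :: "'a \<Rightarrow> nat"
    using fin uv by (simp add: sum.remove[of V u] sum.remove[of "V - {u}" v])
  have "sum (\<lambda>w. (d - hdegree E' w)\<^sup>2) (V - {u} - {v})
      = sum (\<lambda>w. (d - hdegree E w)\<^sup>2) (V - {u} - {v})"
  proof (rule sum.cong)
    fix w assume "w \<in> V - {u} - {v}"
    then show "(d - hdegree E' w)\<^sup>2 = (d - hdegree E w)\<^sup>2" using deg[of w] by simp
  qed simp
  moreover have "(d - hdegree E' u)\<^sup>2 + (d - hdegree E' v)\<^sup>2
      < (d - hdegree E u)\<^sup>2 + (d - hdegree E v)\<^sup>2"
  proof -
    obtain t where t: "d = hdegree E v + 2 + t" using v le_Suc_ex by blast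
    have "d - hdegree E' u \<le> 1" using deg[of u] u uv by simp
    then have "(d - hdegree E' u)\<^sup>2 \<le> 1" using power_mono[of "d - hdegree E' u" 1 2] by simp
    moreover have "d - hdegree E' v = t + 1" "d - hdegree E v = t + 2"
      using deg[of v] uv t by auto
    ultimately show ?thesis using u by (simp add: power2_eq_square)
  qed
  ultimately show ?thesis unfolding deficiency_def by (simp only: split)
qed

section \<open>The minimiser is nearly regular\<close>

lemma linear_nearly_regular_exists:
  fixes V :: "'a set"
  assumes d: "d \<ge> 1" and k: "k \<ge> 2" and fin: "finite V"
    and large: "k + k * (k * k * d * k * d + 1) \<le> card V"
  shows "\<exists>E. uniform_hypergraph k V E \<and> linear_hypergraph E \<and> nearly_regular d k V E"
proof -
  \<comment> \<open>The empty hypergraph is a candidate, so a minimiser exists.\<close>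
  have "bounded_linear_hypergraph d k V {}"
    using fin by (simp add: bounded_linear_hypergraph_def uniform_hypergraph_def
        linear_hypergraph_def hdegree_def)
  from ex_has_least_nat[where P = "bounded_linear_hypergraph d k V" and m = "deficiency d V", OF this]
  obtain E where E: "bounded_linear_hypergraph d k V E"
    and least: "\<And>E'. bounded_linear_hypergraph d k V E' \<Longrightarrow> deficiency d V E \<le> deficiency d V E'"
    by blast
  have U: "uniform_hypergraph k V E" and L: "linear_hypergraph E"
    and deg_le: "\<And>v. v \<in> V \<Longrightarrow> hdegree E v \<le> d"
    using E unfolding bounded_linear_hypergraph_def by auto
  \<comment> \<open>Shared by the fresh edge and the grid switch: raising \<open>k\<close> deficient
    vertices by one keeps all degrees at most \<open>d\<close>, so it would contradict
    minimality.\<close>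
  have no_raise: False
    if "uniform_hypergraph k V E'" "linear_hypergraph E'" "S \<subseteq> V" "card S = k"
      "\<And>v. v \<in> S \<Longrightarrow> hdegree E v < d"
      "\<And>v. hdegree E' v = hdegree E v + of_bool (v \<in> S)" for E' S
  proof -
    have "hdegree E' v \<le> d" if "v \<in> V" for v
      using deg_le[OF that] \<open>\<And>v. v \<in> S \<Longrightarrow> hdegree E v < d\<close>[of v]
        \<open>\<And>v. hdegree E' v = hdegree E v + of_bool (v \<in> S)\<close>[of v] by (cases "v \<in> S") auto
    then have "bounded_linear_hypergraph d k V E'"
      using that unfolding bounded_linear_hypergraph_def by simp
    moreover have "S \<noteq> {}" using that(4) k by auto
    ultimately show False
      using least deficiency_less_raise[OF fin that(3) _ that(5,6)] by (meson leD)
  qed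
  have "\<not> card E * k + k \<le> card V"
  proof
    assume "card E * k + k \<le> card V"
    then obtain E' S where ES: "uniform_hypergraph k V E'" "linear_hypergraph E'"
      "S \<subseteq> V" "card S = k" "\<And>v. v \<in> S \<Longrightarrow> hdegree E v = 0"
      "\<And>v. hdegree E' v = hdegree E v + of_bool (v \<in> S)"
      using fresh_edge[OF k U L] by blast
    show False by (rule no_raise[OF ES(1-4) _ ES(6)]) (use ES(5) d in simp)
  qed
  \<comment> \<open>The bound on \<open>card V\<close> is chosen so that failure of the fresh edge
    step leaves enough edges for the other two switches.\<close>
  then have "k * (k * k * d * k * d + 1) < k * card E" using large by (simp add: mult.commute)
  then have many: "k * k * d * k * d < card E"
    by (metis add_lessD1 mult_less_cancel1)
  define D where "D = {v \<in> V. hdegree E v < d}"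
  have D: "card D < k"
  proof (rule ccontr)
    assume "\<not> card D < k"
    then obtain S where S: "S \<subseteq> D" "card S = k" by (meson not_less obtain_subset_with_card_n)
    then have SV: "S \<subseteq> V" unfolding D_def by blast
    obtain E' where E': "uniform_hypergraph k V E'" "linear_hypergraph E'"
      "\<And>v. hdegree E' v = hdegree E v + of_bool (v \<in> S)"
      using grid_switch[OF k E SV S(2) many] by blast
    show False by (rule no_raise[OF E'(1,2) SV S(2) _ E'(3)]) (use S(1) D_def in blast)
  qed
  have near: "hdegree E v + 1 \<ge> d" if v: "v \<in> V" for v
  proof (rule ccontr)
    assume "\<not> hdegree E v + 1 \<ge> d"
    then have v2: "hdegree E v + 2 \<le> d" by simp
    have DV: "D \<subseteq> V" "v \<in> D" using v v2 unfolding D_def by auto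
    \<comment> \<open>Using all of \<open>D\<close> as the set to avoid forces \<open>u\<close> to
      have degree exactly \<open>d\<close>; as \<open>card D < k\<close>, the edge bound for the
      grid suffices here too.\<close>
    have "card D \<le> k * k" using D k by (meson le_square less_imp_le order_trans)
    then have "card D * d * k * d < card E"
      using many by (meson le_less_trans mult_le_mono1)
    then obtain E' u where E': "uniform_hypergraph k V E'" "linear_hypergraph E'" "u \<in> V - D"
      "\<And>w. hdegree E' w + of_bool (w = u) = hdegree E w + of_bool (w = v)"
      using vertex_switch[OF k E DV] by blast
    have u: "u \<in> V" "u \<noteq> v" "hdegree E u = d"
      using E'(3) DV deg_le[of u] unfolding D_def by auto
    have "hdegree E' w \<le> d" if "w \<in> V" for w
      using E'(4)[of w] deg_le[OF that] v2 by (cases "w = v") auto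
    then have "bounded_linear_hypergraph d k V E'"
      using E' unfolding bounded_linear_hypergraph_def by simp
    then show False
      using least deficiency_less_move[OF fin u(1) v u(2,3) v2 E'(4)] by (meson leD)
  qed
  have "hdegree E v = d \<or> hdegree E v = d - 1" if "v \<in> V" for v
    using near[OF that] deg_le[OF that] by auto
  \<comment> \<open>Here \<open>d \<ge> 1\<close> makes \<open>d - 1\<close> a genuine
    predecessor.\<close>
  moreover have "{v \<in> V. hdegree E v = d - 1} \<subseteq> D" using d unfolding D_def by auto
  then have "card {v \<in> V. hdegree E v = d - 1} < k"
    using D card_mono[of D] fin unfolding D_def by (metis (lifting) finite_Collect_conjI finite_subset
        le_less_trans mem_Collect_eq subsetI)
  ultimately show ?thesis using U L unfolding nearly_regular_def by blast
qed

theorem theorem1p5: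
  fixes d k :: nat
  assumes "d \<ge> 1" and "k \<ge> 2"
  shows "\<exists>N. \<forall>n\<ge>N. \<exists>(V :: nat set) E.
           card V = n \<and> uniform_hypergraph k V E \<and> linear_hypergraph E \<and> nearly_regular d k V E"
proof (rule exI, intro allI impI)
  fix n assume "n \<ge> k + k * (k * k * d * k * d + 1)"
  then have "\<exists>E. uniform_hypergraph k {..<n} E \<and> linear_hypergraph E \<and> nearly_regular d k {..<n} E"
    using linear_nearly_regular_exists[OF assms, of "{..<n}"] by simp
  then show "\<exists>(V :: nat set) E. card V = n \<and> uniform_hypergraph k V E \<and> linear_hypergraph E \<and>
      nearly_regular d k V E"
    using card_lessThan by blast
qed

end
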